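(* Let $\{\mathbf{X}^n\}_{n\in\mathbb{N}_0}$ be a quasi-visual approximation of width $w\in\mathbb{N}_0$ for a bounded metric space $(S,d)$. Then there is a constant $C\ge1$ such that for all distinct points $x,y\in S$ we have $$\frac1C\operatorname{diam}(X^m)\le d(x,y)\le C\operatorname{diam}(X^m),$$ where $m=m_w(x,y)$ and $X^m\in\mathbf{X}^m$ is an arbitrary $m$-tile that contains $x$.
   Context: $\mathbb{N}_0=\{0,1,2,\dots\}$, $\mathbb{N}=\{1,2,\dots\}$. Let $\{\mathbf{X}^n\}_{n\in\mathbb{N}_0}$ be a sequence of covers of $S$ (collections, possibly infinite, of subsets of $S$ with union $S$). Elements of $\mathbf{X}^n$ are called $n$-tiles. For $X\in\mathbf{X}^n$ and $w\in\mathbb{N}_0$, $U_w(X)$ is the union of all $Y\in\mathbf{X}^n$ such that there are $X_0=X,\dots,X_k=Y$ in $\mathbf{X}^n$ with $k\le w$ and $X_j\cap X_{j+1}\neq\emptyset$ for all $j<k$. Let $(S,d)$ be bounded with more than one point. $\{\mathbf{X}^n\}$ is a quasi-visual approximation of width $w$ for $(S,d)$ if $\mathbf{X}^0=\{S\}$ and there are $C\ge1$, $k_0\in\mathbb{N}$, $\lambda\in(0,1)$ such that for all $n\in\mathbb{N}_0$: (1) $\frac1C\operatorname{diam}(Y)\le\operatorname{diam}(X)\le C\operatorname{diam}(Y)$ for $X,Y\in\mathbf{X}^n$ with $X\cap Y\neq\emptyset$; (2) $\operatorname{dist}(X,Y)\ge\frac1C\operatorname{diam}(X)$ for $X,Y\in\mathbf{X}^n$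 with $U_w(X)\cap U_w(Y)=\emptyset$, where $\operatorname{dist}(X,Y)=\inf\{d(x,y):x\in X,\,y\in Y\}$; (3) $\frac1C\operatorname{diam}(Y)\le\operatorname{diam}(X)\le C\operatorname{diam}(Y)$ for $X\in\mathbf{X}^n$, $Y\in\mathbf{X}^{n+1}$ with $X\cap Y\ne\emptyset$; (4) $\operatorname{diam}(Y)\le\lambda\operatorname{diam}(X)$ for $X\in\mathbf{X}^n$, $Y\in\mathbf{X}^{n+k_0}$ with $X\cap Y\ne\emptyset$. For $x,y\in S$, the $U_w$-proximity function $m_w(x,y)\in\mathbb{N}_0\cup\{\infty\}$ is the supremum of all $n\in\mathbb{N}_0$ for which there exist $X,Y\in\mathbf{X}^n$ with $x\in X$, $y\in Y$ and $U_w(X)\cap U_w(Y)\ne\emptyset$. For a quasi-visual approximation of width $w$ one has $m_w(x,y)\in\mathbb{N}_0$ whenever $x\ne y$. *)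

theory Defs
  imports "HOL-Analysis.Analysis" "HOL-Library.Extended_Nat"
begin

text \<open>
  The metric space is a carrier set \<open>S\<close> in a type of class \<open>metric_space\<close>, with the
  restricted metric. A sequence of covers is a function \<open>T\<close> from levels \<open>n\<close> to
  sets of subsets of \<open>S\<close>; the elements of \<open>T n\<close> are the \<open>n\<close>-tiles.
\<close>

definition tile_nbhd :: "nat \<Rightarrow> 'a set set \<Rightarrow> 'a set \<Rightarrow> 'a set" where
  "tile_nbhd w \<A> X =
     \<Union> {Y \<in> \<A>. \<exists>k\<le>w. \<exists>Z :: nat \<Rightarrow> 'a set.
           Z 0 = X \<and> Z k = Y \<and> (\<forall>j\<le>k. Z j \<in> \<A>) \<and> (\<forall>j<k. Z j \<inter> Z (Suc j) \<noteq> {})}"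

text \<open>
  In the separation condition, the library's \<^const>\<open>setdist\<close> is \<open>0\<close> if one of the sets is empty,
  whereas the infimum over the empty set is \<open>\<infinity>\<close>, so that the condition holds
  trivially for an empty tile; hence the restriction to nonempty \<open>X\<close> and \<open>Y\<close> there.
\<close>

definition quasi_visual_approximation ::
    "nat \<Rightarrow> 'a::metric_space set \<Rightarrow> (nat \<Rightarrow> 'a set set) \<Rightarrow> bool" where
  "quasi_visual_approximation w S T \<longleftrightarrow>
     bounded S \<and> (\<exists>x\<in>S. \<exists>y\<in>S. x \<noteq> y) \<and>
     (\<forall>n. \<Union> (T n) = S) \<and>
     T 0 = {S} \<and>
     (\<exists>(C::real) (k0::nat) (l::real). C \<ge> 1 \<and> k0 \<ge> 1 \<and> 0 < l \<and> l < 1 \<and>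
       (\<forall>n.
         (\<forall>X\<in>T n. \<forall>Y\<in>T n. X \<inter> Y \<noteq> {} \<longrightarrow>
            1 / C * diameter Y \<le> diameter X \<and> diameter X \<le> C * diameter Y) \<and>
         (\<forall>X\<in>T n. \<forall>Y\<in>T n. X \<noteq> {} \<and> Y \<noteq> {} \<and> tile_nbhd w (T n) X \<inter> tile_nbhd w (T n) Y = {} \<longrightarrow>
            setdist X Y \<ge> 1 / C * diameter X) \<and>
         (\<forall>X\<in>T n. \<forall>Y\<in>T (n + 1). X \<inter> Y \<noteq> {} \<longrightarrow>
            1 / C * diameter Y \<le> diameter X \<and> diameter X \<le> C * diameter Y) \<and>
         (\<forall>X\<in>T n. \<forall>Y\<in>T (n + k0). X \<inter> Y \<noteq> {} \<longrightarrow>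
            diameter Y \<le> l * diameter X)))"

definition proximity :: "nat \<Rightarrow> (nat \<Rightarrow> 'a set set) \<Rightarrow> 'a \<Rightarrow> 'a \<Rightarrow> enat" where
  "proximity w T x y =
     Sup {enat n | n. \<exists>X\<in>T n. \<exists>Y\<in>T n. x \<in> X \<and> y \<in> Y \<and>
                        tile_nbhd w (T n) X \<inter> tile_nbhd w (T n) Y \<noteq> {}}"

end

theory Submission
  imports Defs
begin

text \<open>
  Why the distance of \<open>x\<close> and \<open>y\<close> is comparable to the size of a tile at the level
  \<open>m\<close> of their proximity: at level \<open>m\<close> there are tiles \<open>X' \<ni> x\<close> and \<open>Y' \<ni> y\<close>
  whose neighbourhoods meet, so \<open>x\<close> and \<open>y\<close> are joined by a chain of at most \<open>2 w + 2\<close> tiles.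
  Consecutive tiles of a chain have comparable diameters, hence all of them are comparable to any
  \<open>m\<close>-tile at \<open>x\<close>, and the triangle inequality bounds \<open>dist x y\<close> from above
  (\<open>dist_le_of_nbhds_meet\<close>). At level \<open>m + 1\<close> no such tiles exist any more, so the
  separation condition bounds \<open>dist x y\<close> from below by the diameter of an \<open>(m + 1)\<close>-tile at
  \<open>x\<close>, and this is comparable to the diameter of any \<open>m\<close>-tile at \<open>x\<close>.

  The level \<open>m\<close> exists because the upper bound holds at every level at which the
  neighbourhoods meet, while the diameters of tiles at \<open>x\<close> tend to \<open>0\<close>
  (\<open>eventually_less_of_block_contraction\<close>); so there are only finitely many such levels, and
  level \<open>0\<close>, with its single tile \<open>S\<close>, is one of them.
\<close>

section \<open>Chains of comparable tiles\<close>

text \<open>Each link of the chain costs a factor \<open>C\<close> in the diameter and one summand in the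
  triangle inequality. Both directions of the diameter comparison are needed: a chain is followed
  away from one of the two points and back towards the other.\<close>

lemma chain_comparison:
  fixes Z :: "nat \<Rightarrow> 'a::metric_space set" and C :: real
  assumes C: "C \<ge> 1"
    and bdd: "\<And>j. j \<le> k \<Longrightarrow> bounded (Z j)"
    and meet: "\<And>j. j < k \<Longrightarrow> Z j \<inter> Z (Suc j) \<noteq> {}"
    and succ_le: "\<And>j. j < k \<Longrightarrow> diameter (Z (Suc j)) \<le> C * diameter (Z j)"
    and pred_le: "\<And>j. j < k \<Longrightarrow> diameter (Z j) \<le> C * diameter (Z (Suc j))"
  shows "diameter (Z k) \<le> C ^ k * diameter (Z 0)
       \<and> diameter (Z 0) \<le> C ^ k * diameter (Z k)
       \<and> (\<forall>x\<in>Z 0. \<forall>z\<in>Z k. dist x z \<le> (real k + 1) * (C ^ k * diameter (Z 0)))"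
  using bdd meet succ_le pred_le
proof (induction k)
  case 0
  then show ?case by (auto intro: diameter_bounded_bound)
next
  case (Suc k)
  let ?D = "diameter (Z 0)"
  have IH: "diameter (Z k) \<le> C ^ k * ?D" "?D \<le> C ^ k * diameter (Z k)"
    "\<And>x z. x \<in> Z 0 \<Longrightarrow> z \<in> Z k \<Longrightarrow> dist x z \<le> (real k + 1) * (C ^ k * ?D)"
    using Suc.IH Suc.prems by auto
  have D: "0 \<le> ?D"
    using Suc.prems(1) by (simp add: diameter_ge_0)
  have "C * diameter (Z k) \<le> C * (C ^ k * ?D)"
    using IH(1) C by (intro mult_left_mono) auto
  then have a: "diameter (Z (Suc k)) \<le> C ^ Suc k * ?D"
    using Suc.prems(3)[of k] by (simp add: mult.assoc)
  have "C ^ k * diameter (Z k) \<le> C ^ k * (C * diameter (Z (Suc k)))"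
    using Suc.prems(4)[of k] C by (intro mult_left_mono) auto
  then have b: "?D \<le> C ^ Suc k * diameter (Z (Suc k))"
    using IH(2) by (simp add: ac_simps)
  have "dist x z \<le> (real (Suc k) + 1) * (C ^ Suc k * ?D)" if x: "x \<in> Z 0" and z: "z \<in> Z (Suc k)" for x z
  proof -
    obtain p where p: "p \<in> Z k" "p \<in> Z (Suc k)"
      using Suc.prems(2)[of k] by auto
    have "C ^ k * ?D \<le> C ^ Suc k * ?D"
      using C D by (intro mult_right_mono power_increasing) auto
    then have "dist x p \<le> (real k + 1) * (C ^ Suc k * ?D)"
      using IH(3)[OF x p(1)] by (smt (verit) mult_left_mono of_nat_0_le_iff)
    moreover have "dist p z \<le> C ^ Suc k * ?D"
      using diameter_bounded_bound[OF Suc.prems(1)[of "Suc k"] p(2) z] a by simp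
    moreover have "dist x z \<le> dist x p + dist p z"
      by (rule dist_triangle)
    ultimately show ?thesis
      by (simp add: algebra_simps)
  qed
  with a b show ?case by blast
qed

lemma tile_nbhd_comparison:
  fixes \<A> :: "'a::metric_space set set" and C :: real
  assumes C: "C \<ge> 1"
    and bdd: "\<forall>X\<in>\<A>. bounded X"
    and comp: "\<forall>X\<in>\<A>. \<forall>Y\<in>\<A>. X \<inter> Y \<noteq> {} \<longrightarrow> diameter X \<le> C * diameter Y"
    and z: "z \<in> tile_nbhd w \<A> X"
  obtains B where "B \<in> \<A>" "z \<in> B"
    "diameter B \<le> C ^ w * diameter X" "diameter X \<le> C ^ w * diameter B"
    "\<And>x. x \<in> X \<Longrightarrow> dist x z \<le> (real w + 1) * (C ^ w * diameter X)"
proof -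
  obtain B k Z where zB: "z \<in> B" "B \<in> \<A>" and k: "k \<le> w"
    and Z: "Z 0 = X" "Z k = B" "\<forall>j\<le>k. Z j \<in> \<A>" "\<forall>j<k. Z j \<inter> Z (Suc j) \<noteq> {}"
    using z unfolding tile_nbhd_def by blast
  have chain: "diameter (Z k) \<le> C ^ k * diameter (Z 0)
      \<and> diameter (Z 0) \<le> C ^ k * diameter (Z k)
      \<and> (\<forall>x\<in>Z 0. \<forall>z\<in>Z k. dist x z \<le> (real k + 1) * (C ^ k * diameter (Z 0)))"
  proof (rule chain_comparison[OF C])
    fix j assume "j < k"
    then have "Z j \<in> \<A>" "Z (Suc j) \<in> \<A>" "Z j \<inter> Z (Suc j) \<noteq> {}" "Z (Suc j) \<inter> Z j \<noteq> {}"
      using Z(3,4) by auto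
    then show "Z j \<inter> Z (Suc j) \<noteq> {}" "diameter (Z (Suc j)) \<le> C * diameter (Z j)"
      "diameter (Z j) \<le> C * diameter (Z (Suc j))"
      using comp by blast+
  qed (use Z bdd in auto)
  have "X \<in> \<A>" using Z by auto
  then have nonneg: "0 \<le> diameter X" "0 \<le> diameter B"
    using bdd zB by (auto intro: diameter_ge_0)
  have pow: "C ^ k \<le> C ^ w"
    using k C by (rule power_increasing)
  then have le: "C ^ k * diameter X \<le> C ^ w * diameter X" "C ^ k * diameter B \<le> C ^ w * diameter B"
    using nonneg by (auto intro: mult_right_mono)
  have "(real k + 1) * (C ^ k * diameter X) \<le> (real w + 1) * (C ^ w * diameter X)"
    using k nonneg(1) C by (intro mult_mono[OF _ le(1)]) auto
  then show thesis
    using that[OF zB(2,1)] chain le zB(1) unfolding Z(1,2)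
    by (smt (verit, best))
qed

text \<open>The chain from \<open>X'\<close> to \<open>z\<close> has at most \<open>w\<close> links, and so has the one from
  \<open>z\<close> back to \<open>Y'\<close>. The exponent counts the comparisons from \<open>X\<close> to
  \<open>X'\<close>, along the first chain, across \<open>z\<close>, and then along the second chain twice: for the
  diameter of \<open>Y'\<close> and for the distance from \<open>z\<close> to \<open>y\<close>.\<close>

lemma dist_le_of_nbhds_meet:
  fixes \<A> :: "'a::metric_space set set" and C :: real
  assumes C: "C \<ge> 1"
    and bdd: "\<forall>X\<in>\<A>. bounded X"
    and comp: "\<forall>X\<in>\<A>. \<forall>Y\<in>\<A>. X \<inter> Y \<noteq> {} \<longrightarrow> diameter X \<le> C * diameter Y"
    and tiles: "X' \<in> \<A>" "Y' \<in> \<A>" "x \<in> X'" "y \<in> Y'"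
    and meet: "tile_nbhd w \<A> X' \<inter> tile_nbhd w \<A> Y' \<noteq> {}"
    and X: "X \<in> \<A>" "x \<in> X"
  shows "dist x y \<le> 2 * (real w + 1) * C ^ (3 * w + 2) * diameter X"
proof -
  obtain z where z: "z \<in> tile_nbhd w \<A> X'" "z \<in> tile_nbhd w \<A> Y'"
    using meet by auto
  obtain A where A: "A \<in> \<A>" "z \<in> A" "diameter A \<le> C ^ w * diameter X'"
    "dist x z \<le> (real w + 1) * (C ^ w * diameter X')"
    using tile_nbhd_comparison[OF C bdd comp z(1)] tiles(3) by metis
  obtain B where B: "B \<in> \<A>" "z \<in> B" "diameter Y' \<le> C ^ w * diameter B"
    "dist y z \<le> (real w + 1) * (C ^ w * diameter Y')"
    using tile_nbhd_comparison[OF C bdd comp z(2)] tiles(4) by metis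
  let ?D = "diameter X"
  have D: "0 \<le> ?D" using X bdd by (auto intro: diameter_ge_0)
  have X': "diameter X' \<le> C * ?D"
    using comp tiles X by blast
  have "diameter B \<le> C * diameter A"
    using comp A B by blast
  also have "\<dots> \<le> C * (C ^ w * (C * ?D))"
    using A(3) X' C by (smt (verit, best) mult_left_mono zero_le_power)
  finally have "C ^ w * diameter B \<le> C ^ w * (C * (C ^ w * (C * ?D)))"
    using C by (intro mult_left_mono) auto
  then have "diameter Y' \<le> C ^ w * (C * (C ^ w * (C * ?D)))"
    using B(3) by simp
  then have "C ^ w * diameter Y' \<le> C ^ w * (C ^ w * (C * (C ^ w * (C * ?D))))"
    using C by (intro mult_left_mono) auto
  also have "\<dots> = C ^ (3 * w + 2) * ?D"
    by (simp add: power_add power2_eq_square power_mult power3_eq_cube algebra_simps)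
  finally have Y: "C ^ w * diameter Y' \<le> C ^ (3 * w + 2) * ?D" .
  have "C ^ w * diameter X' \<le> C ^ w * (C * ?D)"
    using X' C by (intro mult_left_mono) auto
  also have "\<dots> = C ^ (w + 1) * ?D" by simp
  also have "\<dots> \<le> C ^ (3 * w + 2) * ?D"
    using C D by (intro mult_right_mono power_increasing) auto
  finally have X: "C ^ w * diameter X' \<le> C ^ (3 * w + 2) * ?D" .
  have "dist x y \<le> dist x z + dist y z"
    by (rule dist_triangle2)
  also have "\<dots> \<le> (real w + 1) * (C ^ (3 * w + 2) * ?D) + (real w + 1) * (C ^ (3 * w + 2) * ?D)"
    using A(4) B(4) mult_left_mono[OF X, of "real w + 1"] mult_left_mono[OF Y, of "real w + 1"]
    by linarith
  finally show ?thesis by (simp add: algebra_simps)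
qed

section \<open>Decay of tile diameters\<close>

text \<open>Contraction is only known over blocks of length \<open>k\<close>; inside a block the sequence may
  grow, but by at most the factor \<open>C ^ k\<close>.\<close>

lemma eventually_less_of_block_contraction:
  fixes a :: "nat \<Rightarrow> real" and C l e :: real
  assumes C: "C \<ge> 1" and k: "k \<ge> 1" and l: "0 < l" "l < 1" and e: "0 < e"
    and nonneg: "\<And>n. 0 \<le> a n"
    and step: "\<And>n. a (Suc n) \<le> C * a n"
    and block: "\<And>n. a (n + k) \<le> l * a n"
  shows "\<forall>\<^sub>F n in sequentially. a n < e"
proof -
  have grow: "a r \<le> C ^ r * a 0" for r
  proof (induction r)
    case (Suc r)
    then have "C * a r \<le> C * (C ^ r * a 0)"
      using C by (intro mult_left_mono) auto
    then show ?case using step[of r] by (simp add: mult.assoc)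
  qed simp
  have shrink: "a (r + k * q) \<le> l ^ q * a r" for r q
  proof (induction q)
    case (Suc q)
    have "a (r + k * Suc q) \<le> l * a (r + k * q)"
      using block[of "r + k * q"] by (simp add: algebra_simps)
    also have "\<dots> \<le> l * (l ^ q * a r)"
      using Suc l by (intro mult_left_mono) auto
    finally show ?case by (simp add: mult.assoc)
  qed simp
  have "(\<lambda>q. l ^ q * (C ^ k * a 0)) \<longlonglongrightarrow> 0 * (C ^ k * a 0)"
    using l by (intro tendsto_mult tendsto_const LIMSEQ_power_zero) auto
  then have "\<forall>\<^sub>F q in sequentially. l ^ q * (C ^ k * a 0) < e"
    using e by (auto dest: order_tendstoD(2))
  then obtain Q where Q: "\<And>q. q \<ge> Q \<Longrightarrow> l ^ q * (C ^ k * a 0) < e"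
    by (auto simp: eventually_sequentially)
  have "a n < e" if n: "n \<ge> k * Q" for n
  proof -
    have q: "n div k \<ge> Q"
      using n k by (simp add: less_eq_div_iff_mult_less_eq mult.commute)
    have "a n \<le> l ^ (n div k) * a (n mod k)"
      using shrink[of "n mod k" "n div k"] by simp
    also have "\<dots> \<le> l ^ (n div k) * (C ^ (n mod k) * a 0)"
      using l grow by (intro mult_left_mono) auto
    also have "\<dots> \<le> l ^ (n div k) * (C ^ k * a 0)"
      using l C k nonneg by (intro mult_left_mono mult_right_mono power_increasing) auto
    also have "\<dots> < e" by (rule Q[OF q])
    finally show ?thesis .
  qed
  then show ?thesis by (auto simp: eventually_sequentially)
qed

section \<open>Distance and proximity\<close>

lemma Sup_enat_image_eq_Max:
  assumes "finite N" "N \<noteq> {}"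
  shows "Sup (enat ` N) = enat (Max N)"
  using assms by (simp add: Sup_enat_def mono_Max_commute[symmetric] mono_def)

theorem lemma5p4:
  fixes S :: "'a::metric_space set" and T :: "nat \<Rightarrow> 'a set set" and w :: nat
  assumes "quasi_visual_approximation w S T"
  shows "\<exists>C::real. C \<ge> 1 \<and>
    (\<forall>x\<in>S. \<forall>y\<in>S. x \<noteq> y \<longrightarrow>
      (\<exists>m::nat. proximity w T x y = enat m \<and>
        (\<forall>X\<in>T m. x \<in> X \<longrightarrow>
          1 / C * diameter X \<le> dist x y \<and> dist x y \<le> C * diameter X)))"
proof -
  from assms have S: "bounded S" and cover: "\<And>n. \<Union> (T n) = S" and T0: "T 0 = {S}"
    unfolding quasi_visual_approximation_def by auto
  from assms obtain C l :: real and k0 :: nat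
    where C: "C \<ge> 1" and k0: "k0 \<ge> 1" and l: "0 < l" "l < 1"
      and qva: "\<forall>n.
         (\<forall>X\<in>T n. \<forall>Y\<in>T n. X \<inter> Y \<noteq> {} \<longrightarrow>
            1 / C * diameter Y \<le> diameter X \<and> diameter X \<le> C * diameter Y) \<and>
         (\<forall>X\<in>T n. \<forall>Y\<in>T n. X \<noteq> {} \<and> Y \<noteq> {} \<and> tile_nbhd w (T n) X \<inter> tile_nbhd w (T n) Y = {} \<longrightarrow>
            setdist X Y \<ge> 1 / C * diameter X) \<and>
         (\<forall>X\<in>T n. \<forall>Y\<in>T (n + 1). X \<inter> Y \<noteq> {} \<longrightarrow>
            1 / C * diameter Y \<le> diameter X \<and> diameter X \<le> C * diameter Y) \<and>
         (\<forall>X\<in>T n. \<forall>Y\<in>T (n + k0). X \<inter> Y \<noteq> {} \<longrightarrow>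
            diameter Y \<le> l * diameter X)"
    unfolding quasi_visual_approximation_def by (elim conjE exE) (rule that)
  have comp: "\<forall>X\<in>T n. \<forall>Y\<in>T n. X \<inter> Y \<noteq> {} \<longrightarrow> diameter X \<le> C * diameter Y" for n
    using qva by simp
  have up: "diameter X \<le> C * diameter Y" if "X \<in> T n" "Y \<in> T (n + 1)" "X \<inter> Y \<noteq> {}" for n X Y
    using qva that by simp
  have block: "diameter Y \<le> l * diameter X" if "X \<in> T n" "Y \<in> T (n + k0)" "X \<inter> Y \<noteq> {}" for n X Y
    using qva that by simp
  have sep: "diameter X \<le> C * dist x y"
    if "X \<in> T n" "Y \<in> T n" "x \<in> X" "y \<in> Y" "tile_nbhd w (T n) X \<inter> tile_nbhd w (T n) Y = {}" for n X Y x y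
  proof -
    have "1 / C * diameter X \<le> dist x y"
      using qva that setdist_le_dist[of x X y Y] by (metis empty_iff order_trans)
    then show ?thesis using C by (simp add: field_simps)
  qed
  have down: "diameter Y \<le> C * diameter X" if "X \<in> T n" "Y \<in> T (n + 1)" "X \<inter> Y \<noteq> {}" for n X Y
  proof -
    have "1 / C * diameter Y \<le> diameter X"
      using qva that by simp
    then show ?thesis using C by (simp add: field_simps)
  qed
  have bdd: "\<forall>X\<in>T n. bounded X" for n
    using cover[of n] S by (metis Sup_upper bounded_subset)

  define K where "K = 2 * (real w + 1) * C ^ (3 * w + 2)"
  have K1: "K \<ge> 1"
  proof -
    have "1 * 1 \<le> (2 * (real w + 1)) * C ^ (3 * w + 2)"
      using C by (intro mult_mono one_le_power) auto
    then show ?thesis by (simp add: K_def)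
  qed
  define C' where "C' = max K (C * C)"
  have C': "C' \<ge> 1" "K \<le> C'" "C * C \<le> C'"
    using K1 by (auto simp: C'_def)

  have "\<exists>m::nat. proximity w T x y = enat m \<and>
        (\<forall>X\<in>T m. x \<in> X \<longrightarrow> 1 / C' * diameter X \<le> dist x y \<and> dist x y \<le> C' * diameter X)"
    if x: "x \<in> S" and y: "y \<in> S" and ne: "x \<noteq> y" for x y
  proof -
    define N where "N = {n. \<exists>X\<in>T n. \<exists>Y\<in>T n. x \<in> X \<and> y \<in> Y \<and>
                        tile_nbhd w (T n) X \<inter> tile_nbhd w (T n) Y \<noteq> {}}"
    have upper: "dist x y \<le> K * diameter X" if "n \<in> N" "X \<in> T n" "x \<in> X" for n X
    proof -
      obtain X' Y' where "X' \<in> T n" "Y' \<in> T n" "x \<in> X'" "y \<in> Y'"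
        "tile_nbhd w (T n) X' \<inter> tile_nbhd w (T n) Y' \<noteq> {}"
        using \<open>n \<in> N\<close> unfolding N_def by blast
      then show ?thesis
        unfolding K_def using that by (intro dist_le_of_nbhds_meet[OF C bdd comp])
    qed
    have "\<exists>X\<in>T n. x \<in> X" for n
      using x cover[of n] by auto
    then obtain F where F: "\<And>n. F n \<in> T n" "\<And>n. x \<in> F n"
      by metis

    have "\<forall>\<^sub>F n in sequentially. diameter (F n) < dist x y / K"
    proof (rule eventually_less_of_block_contraction[OF C k0 l])
      show "0 < dist x y / K" using ne K1 by simp
      fix n
      show "0 \<le> diameter (F n)" using bdd F by (auto intro: diameter_ge_0)
      show "diameter (F (Suc n)) \<le> C * diameter (F n)" using down[of "F n" n "F (Suc n)"] F by auto
      show "diameter (F (n + k0)) \<le> l * diameter (F n)" using block[of "F n" n "F (n + k0)"] F by auto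
    qed
    then obtain n0 where n0: "\<And>n. n \<ge> n0 \<Longrightarrow> diameter (F n) < dist x y / K"
      by (auto simp: eventually_sequentially)
    have "n < n0" if "n \<in> N" for n
    proof (rule ccontr)
      assume "\<not> n < n0"
      then have "K * diameter (F n) < dist x y"
        using n0[of n] K1 by (simp add: field_simps)
      with upper[OF that F] show False by simp
    qed
    then have fin: "finite N"
      by (auto intro: finite_subset[of N "{..<n0}"])
    \<comment> \<open>The chain of length \<open>0\<close> shows that \<open>S\<close> lies in its own neighbourhood.\<close>
    have "S \<subseteq> tile_nbhd w (T 0) S"
      unfolding tile_nbhd_def T0 by (auto intro!: exI[of _ 0] exI[of _ "\<lambda>_. S"])
    then have "0 \<in> N"
      using x y by (auto simp: N_def T0)
    then have Nne: "N \<noteq> {}" by auto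
    define m where "m = Max N"
    have m: "m \<in> N" "Suc m \<notin> N"
      using Max_in[OF fin Nne] Max_ge[OF fin, of "Suc m"] by (auto simp: m_def)
    have prox: "proximity w T x y = enat m"
      unfolding m_def Sup_enat_image_eq_Max[OF fin Nne, symmetric]
      by (simp add: proximity_def N_def image_Collect)
    have "1 / C' * diameter X \<le> dist x y \<and> dist x y \<le> C' * diameter X" if X: "X \<in> T m" "x \<in> X" for X
    proof
      have D: "0 \<le> diameter X" using X bdd by (auto intro: diameter_ge_0)
      show "dist x y \<le> C' * diameter X"
        using upper[OF m(1) X] mult_right_mono[OF C'(2) D] by simp
      obtain Y where Y: "Y \<in> T (Suc m)" "y \<in> Y"
        using y cover[of "Suc m"] by auto
      have "diameter (F (Suc m)) \<le> C * dist x y"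
        using sep[OF F(1) Y(1) F(2) Y(2)] m(2) F Y unfolding N_def by blast
      moreover have "diameter X \<le> C * diameter (F (Suc m))"
        using up[of X m "F (Suc m)"] X F by auto
      ultimately have "diameter X \<le> C * (C * dist x y)"
        using C by (smt (verit, best) mult_left_mono)
      also have "\<dots> \<le> C' * dist x y"
        using mult_right_mono[OF C'(3), of "dist x y"] by (simp add: mult.assoc)
      finally show "1 / C' * diameter X \<le> dist x y"
        using C'(1) by (simp add: field_simps)
    qed
    with prox show ?thesis by blast
  qed
  with C'(1) show ?thesis by blast
qed

end
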